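(* Let $n=2$, $m=2$, $q=2$, and $f:\mathbb{R}^2_{\ge0}\to\mathbb{R}_{\ge0}$, $f(x)=\mathbf{1}\{x(1)>1/2\text{ and }x(2)>1/2\}$ (which is Schur-concave). There is a randomized allocation policy $\mathcal{A}$ such that for all $\alpha>0$, $$\textsc{Reg}^{\max}_{(2,2,2),\alpha,f}(\mathcal{A})\le\max(\alpha-\tfrac12,0)<\alpha\le\textsc{Reg}^{\max}_{(2,2,2),\alpha,f}(\textsc{WF}).$$
   Context: Offline nodes are $[n]$. A request sequence is $E=((N_t,q_t))_{t\in[m]}$ with nonempty $N_t\subseteq[n]$ and $q_t>0$; $\mathcal{E}_{n,m,q}$: such sequences with $\sum_tq_t=q$. $\Delta(N,q)=\{x\in\mathbb{R}^n_{\ge0}: x(i)=0\ \forall i\notin N,\ \sum_ix(i)=q\}$, $\Delta(E)=\sum_t\Delta(N_t,q_t)$ (Minkowski sum). An allocation policy $\mathcal{A}$ chooses, upon arrival of node $t$, $x_t\in\Delta(N_t,q_t)$ as a function of the arrivals so far, its past allocations and (if randomized) its internal randomness; $\mathcal{A}(E)=\sum_tx_t$. Water-filling ($\textsc{WF}$) is the deterministic policy choosing the unique $x_t\in\Delta(N_t,q_t)$ maximizing $\min_{i\in N_t}(x_t(i)+\sum_{s<t}x_s(i))$. Regret against an oblivious adversary (the sequence is chosen knowing $\mathcal{A}$ but not its coin flips): $\textsc{Reg}^{\max}_{(n,m,q),\alpha,f}(\mathcal{A})=\sup_{E\in\mathcal{E}_{n,m,q}}\big(\alpha\max_{\ell\in\Delta(E)}f(\ell)-\mathbb{E}[f(\mathcal{A}(E))]\big)$.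 *)

theory Defs
  imports "HOL-Probability.Probability"
begin

text \<open>
  The offline nodes are the elements of a finite type \<open>'n\<close>, so \<open>n\<close> is \<open>CARD('n)\<close> and a load vector
  is an element of \<open>real ^ 'n\<close>. A request is a pair of a neighbourhood and a quantity.
\<close>

type_synonym 'n request = "'n set \<times> real"

definition nonneg_vecs :: "(real ^ 'n::finite) set" where
  "nonneg_vecs = {x. \<forall>i. 0 \<le> x $ i}"

definition valid_requests :: "'n::finite request list \<Rightarrow> bool" where
  "valid_requests E \<longleftrightarrow> (\<forall>(N, q) \<in> set E. N \<noteq> {} \<and> q > 0)"

definition request_seqs :: "nat \<Rightarrow> real \<Rightarrow> 'n::finite request list set" where
  "request_seqs m q = {E. length E = m \<and> valid_requests E \<and> (\<Sum>(N, p) \<leftarrow> E. p) = q}"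

definition feasible :: "'n::finite request \<Rightarrow> (real ^ 'n) set" where
  "feasible = (\<lambda>(N, q). {x \<in> nonneg_vecs. (\<forall>i. i \<notin> N \<longrightarrow> x $ i = 0) \<and> (\<Sum>i\<in>UNIV. x $ i) = q})"

definition feasible_loads :: "'n::finite request list \<Rightarrow> (real ^ 'n) set" where
  "feasible_loads E =
     {(\<Sum>t<length E. y t) | y. \<forall>t<length E. y t \<in> feasible (E ! t)}"

text \<open>
  A policy consists of a probability space of seeds, modelling all of its internal randomness, and
  a rule that maps a seed, the arrivals so far (including the current one, which is the last list
  element) and the past allocations to the current allocation. The seed is drawn once,
  independently of the request sequence.
\<close>

type_synonym ('s, 'n) policy =
  "'s measure \<times> ('s \<Rightarrow> 'n request list \<Rightarrow> (real ^ 'n) list \<Rightarrow> real ^ 'n)"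

primrec allocations ::
  "('s \<Rightarrow> 'n request list \<Rightarrow> (real ^ 'n) list \<Rightarrow> real ^ 'n) \<Rightarrow> 's \<Rightarrow> 'n request list \<Rightarrow> nat
     \<Rightarrow> (real ^ 'n::finite) list"
where
  "allocations R \<omega> E 0 = []"
| "allocations R \<omega> E (Suc t) =
     allocations R \<omega> E t @ [R \<omega> (take (Suc t) E) (allocations R \<omega> E t)]"

definition final_load :: "('s, 'n::finite) policy \<Rightarrow> 'n request list \<Rightarrow> 's \<Rightarrow> real ^ 'n" where
  "final_load A E \<omega> = sum_list (allocations (snd A) \<omega> E (length E))"

text \<open>
  Prefixes of valid request lists are valid, so measurability of all final loads amounts to
  measurability of all individual allocations.
\<close>

definition allocation_policy :: "('s, 'n::finite) policy \<Rightarrow> bool" where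
  "allocation_policy A \<longleftrightarrow>
     prob_space (fst A) \<and>
     (\<forall>\<omega> \<in> space (fst A). \<forall>E r xs.
        valid_requests (E @ [r]) \<and> length xs = length E \<and>
        (\<forall>s<length E. xs ! s \<in> feasible (E ! s)) \<longrightarrow>
        snd A \<omega> (E @ [r]) xs \<in> feasible r) \<and>
     (\<forall>E. valid_requests E \<longrightarrow> final_load A E \<in> borel_measurable (fst A))"

definition water_filling :: "(unit, 'n::finite) policy" where
  "water_filling =
     (return (count_space UNIV) (),
      \<lambda>_ E xs. THE x.
        is_arg_max (\<lambda>x. MIN i \<in> fst (last E). x $ i + sum_list xs $ i)
          (\<lambda>x. x \<in> feasible (last E)) x)"

text \<open>
  The offline optimum is a genuine maximum, as \<open>Greatest\<close> on the reals; it is meaningful only if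
  \<open>f\<close> attains its maximum on the set of feasible loads. The supremum over request sequences is
  taken in the extended reals, where it always exists.
\<close>

definition regret_max ::
  "nat \<Rightarrow> real \<Rightarrow> real \<Rightarrow> (real ^ 'n::finite \<Rightarrow> real) \<Rightarrow> ('s, 'n) policy \<Rightarrow> ereal"
where
  "regret_max m q \<alpha> f A =
     (SUP E \<in> request_seqs m q.
        ereal (\<alpha> * (GREATEST v. v \<in> f ` feasible_loads E)
               - (\<integral>\<omega>. f (final_load A E \<omega>) \<partial>fst A)))"

definition decreasing_rearrangement :: "real ^ 'n::finite \<Rightarrow> real list" where
  "decreasing_rearrangement x =
     rev (sorted_list_of_multiset (image_mset (($) x) (mset_set UNIV)))"

definition majorized_by :: "real ^ 'n::finite \<Rightarrow> real ^ 'n \<Rightarrow> bool" where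
  "majorized_by x y \<longleftrightarrow>
     (\<forall>k \<le> CARD('n). sum_list (take k (decreasing_rearrangement x))
                     \<le> sum_list (take k (decreasing_rearrangement y))) \<and>
     (\<Sum>i\<in>UNIV. x $ i) = (\<Sum>i\<in>UNIV. y $ i)"

definition schur_concave_on :: "(real ^ 'n::finite) set \<Rightarrow> (real ^ 'n \<Rightarrow> real) \<Rightarrow> bool" where
  "schur_concave_on S f \<longleftrightarrow> (\<forall>x\<in>S. \<forall>y\<in>S. majorized_by x y \<longrightarrow> f y \<le> f x)"

end

theory Submission
  imports Defs
begin

text \<open>
  Both coordinates of a load exceed \<open>1/2\<close> iff its minimum does. Water-filling answers the request
  \<open>({1, 2}, 1)\<close> with \<open>(1/2, 1/2)\<close>, and the request \<open>({1}, 1)\<close> then leaves coordinate \<open>2\<close> at exactly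
  \<open>1/2\<close>, although \<open>(1, 1)\<close> was achievable. A better policy puts a first
  request of size at most \<open>1\<close> with two neighbours entirely on the node chosen by a fair coin; the second
  request has size at least \<open>1\<close>, and at least one outcome of the coin leads to success whenever success is
  possible at all. A larger first request is split evenly, which already suffices.
\<close>

section \<open>Feasible allocations on two nodes\<close>

lemma feasible_2:
  "x \<in> feasible (N, q) \<longleftrightarrow>
     0 \<le> x $ 1 \<and> 0 \<le> x $ 2 \<and> (1 \<notin> N \<longrightarrow> x $ 1 = 0) \<and> (2 \<notin> N \<longrightarrow> x $ 2 = 0) \<and> x $ 1 + x $ 2 = q"
  for x :: "real ^ 2"
  by (auto simp: feasible_def nonneg_vecs_def forall_2 sum_2)

lemma nonempty_set_2_cases:
  fixes N :: "2 set"
  assumes "N \<noteq> {}"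
  obtains "N = UNIV" | "N = {1}" | "N = {2}"
proof -
  have "N \<subseteq> {1, 2}" by (simp flip: UNIV_2)
  then have "N = {1, 2} \<or> N = {1} \<or> N = {2}" using assms by auto
  then show ?thesis using that by (auto simp: UNIV_2)
qed

lemma feasible_singleton:
  "x \<in> feasible ({i}, q) \<longleftrightarrow> 0 \<le> q \<and> x = axis i q"
  for x :: "real ^ 2"
  using exhaust_2[of i] by (auto simp: feasible_2 vec_eq_iff forall_2 axis_def)

section \<open>Balanced filling and the coin policy\<close>

text \<open>Closed form of water-filling a request of size \<open>q\<close> at both nodes on top of
  load \<open>l\<close>: the root \<open>a\<close> of \<open>l $ 1 + a = l $ 2 + q - a\<close>,
  clamped to the interval from 0 to \<open>q\<close>.\<close>

definition fill :: "real \<Rightarrow> real ^ 2 \<Rightarrow> real ^ 2" where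
  "fill q l = (let a = max 0 (min q ((q + l $ 2 - l $ 1) / 2)) in vector [a, q - a])"

lemma fill_feasible: "0 \<le> q \<Longrightarrow> fill q l \<in> feasible (UNIV, q)"
  by (auto simp: feasible_2 fill_def Let_def)

text \<open>If the levels can be equalized, both equal half of the total load, which exceeds
  \<open>c\<close> for any successful \<open>y\<close>. Otherwise all of \<open>q\<close> goes to
  the lower node, which ends at least as high as under \<open>y\<close>, and the other node stays at
  least as high as that one.\<close>

lemma fill_maximizes_min:
  assumes "y \<in> feasible (UNIV, q)" "\<forall>i. c < (l + y) $ i"
  shows "\<forall>i. c < (l + fill q l) $ i"
  using assms by (auto simp: feasible_2 fill_def Let_def forall_2 max_def min_def field_simps)

text \<open>The list \<open>E\<close> includes the current request, so \<open>length E = 1\<close>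
  singles out the first arrival, the only one for which the seed matters. Seed 0 stands for node 1,
  any other seed for node 2.\<close>

definition coin_rule :: "real \<Rightarrow> 2 request list \<Rightarrow> (real ^ 2) list \<Rightarrow> real ^ 2" where
  "coin_rule \<omega> E xs =
     (case last E of (N, q) \<Rightarrow>
        if N = UNIV then
          if length E = 1 \<and> q \<le> 1 then axis (if \<omega> = 0 then 1 else 2) q else fill q (sum_list xs)
        else axis (THE i. N = {i}) q)"

definition coin_policy :: "(real, 2) policy" where
  "coin_policy = (measure_pmf (pmf_of_set {0, 1}), coin_rule)"

lemma singleton_neq_UNIV_2 [simp]: "{i} \<noteq> (UNIV :: 2 set)"
  using one_neq_zero[where ?'a = 2] by (metis UNIV_I singletonD)

lemma coin_rule_feasible:
  assumes "N \<noteq> {}" "0 < q"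
  shows "coin_rule \<omega> (E @ [(N, q)]) xs \<in> feasible (N, q)"
  using assms(1)
proof (cases rule: nonempty_set_2_cases)
  case 1
  then show ?thesis using assms(2) fill_feasible[of q "sum_list xs"]
    by (auto simp: coin_rule_def feasible_2 axis_def)
qed (use assms(2) in \<open>simp_all add: coin_rule_def feasible_singleton\<close>)

text \<open>Measurability is automatic: every set is measurable for a \<open>pmf\<close>.\<close>

lemma allocation_policy_coin: "allocation_policy coin_policy"
  using measure_pmf.prob_space_axioms
  by (auto simp: allocation_policy_def coin_policy_def valid_requests_def intro!: coin_rule_feasible)

section \<open>Two-request sequences and success of the coin policy\<close>

lemma final_load_two:
  "final_load A [r, s] \<omega> = snd A \<omega> [r] [] + snd A \<omega> [r, s] [snd A \<omega> [r] []]"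
  by (simp add: final_load_def)

lemma feasible_loads_two:
  "feasible_loads [r, s] = {x + y | x y. x \<in> feasible r \<and> y \<in> feasible s}"
proof -
  have "\<exists>z. x + y = (\<Sum>t<2. z t) \<and> (\<forall>t<2. z t \<in> feasible ([r, s] ! t))"
    if "x \<in> feasible r" "y \<in> feasible s" for x y
    by (rule exI[of _ "\<lambda>t. if t = 0 then x else y"]) (use that in \<open>auto simp: numeral_2_eq_2 less_Suc_eq\<close>)
  then have "{x + y | x y. x \<in> feasible r \<and> y \<in> feasible s} \<subseteq> feasible_loads [r, s]"
    unfolding feasible_loads_def by (simp add: numeral_2_eq_2) blast
  moreover have "feasible_loads [r, s] \<subseteq> {x + y | x y. x \<in> feasible r \<and> y \<in> feasible s}"
    by (auto simp: feasible_loads_def less_Suc_eq)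
  ultimately show ?thesis by blast
qed

lemma request_seqs_two_cases:
  assumes "E \<in> request_seqs 2 p"
  obtains N q N' q' where "E = [(N, q), (N', q')]" "N \<noteq> {}" "N' \<noteq> {}" "0 < q" "0 < q'" "q + q' = p"
proof -
  from assms have "length E = Suc (Suc 0)" by (simp add: request_seqs_def)
  then obtain r s where E: "E = [r, s]" by (auto simp: length_Suc_conv)
  show ?thesis
    by (rule that[of "fst r" "snd r" "fst s" "snd s"])
       (use assms in \<open>auto simp: E request_seqs_def valid_requests_def split_beta\<close>)
qed

text \<open>The second answer is optimal for whatever load \<open>x\<close> the first one left: it
  is either forced by a single neighbour or given by \<open>fill\<close>.\<close>

lemma coin_rule_second:
  assumes "y \<in> feasible (N, q)" "N \<noteq> {}" "\<forall>i. c < (x + y) $ i"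
  shows "\<forall>i. c < (x + coin_rule \<omega> [r, (N, q)] [x]) $ i"
  using assms(2)
proof (cases rule: nonempty_set_2_cases)
  case 1
  then show ?thesis using assms fill_maximizes_min[of y q c x] by (simp add: coin_rule_def)
qed (use assms in \<open>simp_all add: coin_rule_def feasible_singleton\<close>)

lemma coin_success:
  assumes N: "N \<noteq> {}" "N' \<noteq> {}" and q: "0 < q" "0 < q'" "q + q' = 2"
    and x: "x \<in> feasible (N, q)" and y: "y \<in> feasible (N', q')"
    and good: "\<forall>i. 1/2 < (x + y) $ i"
  shows "\<exists>\<omega>\<in>{0, 1}. \<forall>i. 1/2 < final_load coin_policy [(N, q), (N', q')] \<omega> $ i"
proof -
  define first where "first \<omega> = coin_rule \<omega> [(N, q)] []" for \<omega>
  \<comment> \<open>By optimality of the second answer, it is enough to exhibit any successful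
    second allocation \<open>z\<close> for one of the two seeds.\<close>
  have suff: ?thesis
    if "\<omega> \<in> {0, 1}" "z \<in> feasible (N', q')" "\<forall>i. 1/2 < (first \<omega> + z) $ i" for \<omega> z
    using coin_rule_second[OF that(2) N(2) that(3)] that(1)
    by (auto simp: final_load_two coin_policy_def first_def)
  show ?thesis
    using N(1)
  proof (cases rule: nonempty_set_2_cases)
    case 1
    show ?thesis
    proof (cases "q \<le> 1")
      case False
      \<comment> \<open>Since \<open>q > 1\<close>, the even split alone lifts both nodes above 1/2,
        so any second allocation will do.\<close>
      then have "fill q 0 = vector [q / 2, q / 2]"
        by (simp add: fill_def Let_def)
      with False have "\<forall>i. 1/2 < (first 0 + y) $ i"
        using y by (simp add: first_def coin_rule_def 1 forall_2 feasible_2)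
      then show ?thesis
        using suff[of 0 y] y by blast
    next
      case True
      then have first: "first \<omega> = axis (if \<omega> = 0 then 1 else 2) q" for \<omega>
        by (simp add: first_def coin_rule_def 1)
      show ?thesis
        using N(2)
      proof (cases rule: nonempty_set_2_cases)
        case U: 1
        \<comment> \<open>If \<open>q \<le> 1/2\<close>, then \<open>q' / 2 \<ge> 3/4\<close> for
          both nodes. Otherwise node 1 is already above 1/2 and node 2 receives
          \<open>q' \<ge> 1\<close>.\<close>
        define z :: "real ^ 2" where "z = (if q \<le> 1/2 then vector [q' / 2, q' / 2] else vector [0, q'])"
        show ?thesis
          by (rule suff[of 0 z])
             (use q True in \<open>auto simp: U first z_def feasible_2 forall_2 axis_def\<close>)
      next
        case 2
        \<comment> \<open>Node 2 is served by the first request only, so \<open>good\<close> forces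
          \<open>q > 1/2\<close>; seed 1 puts all of \<open>q\<close> there, and node 1 gets
          \<open>q' \<ge> 1\<close>. The case below is its mirror image, with seed 0.\<close>
        show ?thesis
          by (rule suff[of 1 y])
             (use q True x y good in \<open>auto simp: 2 first feasible_2 forall_2 axis_def\<close>)
      next
        case 3
        show ?thesis
          by (rule suff[of 0 y])
             (use q True x y good in \<open>auto simp: 3 first feasible_2 forall_2 axis_def\<close>)
      qed
    qed
  next
    case 2
    \<comment> \<open>A single neighbour forces the first allocation, so the policy reproduces
      \<open>x\<close> under either seed.\<close>
    then have "first 0 = x" using x by (simp add: first_def coin_rule_def feasible_singleton)
    then show ?thesis using suff[of 0 y] y good by simp
  next
    case 3
    then have "first 0 = x" using x by (simp add: first_def coin_rule_def feasible_singleton)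
    then show ?thesis using suff[of 0 y] y good by simp
  qed
qed

section \<open>Explicit values for both policies\<close>

lemma integral_coin_policy:
  "(\<integral>\<omega>. g \<omega> \<partial>fst coin_policy) = (g 0 + g 1) / 2" for g :: "real \<Rightarrow> real"
  by (simp add: coin_policy_def integral_pmf_of_set)

text \<open>The coordinates sum to \<open>q\<close>, so their minimum is at most
  \<open>q / 2\<close>, with equality only for the even split; hence the maximizer is unique and
  \<open>THE\<close> is well defined.\<close>

lemma water_filling_first:
  "snd water_filling () [(UNIV, q)] [] = (vector [q / 2, q / 2] :: real ^ 2)" if "0 \<le> q"
proof -
  have "(MIN i\<in>UNIV. x $ i) = min (x $ 1) (x $ 2)" for x :: "real ^ 2"
    by (simp add: UNIV_2)
  then have "is_arg_max (\<lambda>x :: real ^ 2. MIN i\<in>UNIV. x $ i) (\<lambda>x. x \<in> feasible (UNIV, q)) x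
      \<longleftrightarrow> x \<in> feasible (UNIV, q) \<and> \<not> (\<exists>y \<in> feasible (UNIV :: 2 set, q). min (x $ 1) (x $ 2) < min (y $ 1) (y $ 2))"
    for x
    by (auto simp: is_arg_max_def)
  moreover have "x = vector [q / 2, q / 2]"
    if x: "x \<in> feasible (UNIV, q)"
      and max: "\<not> (\<exists>y \<in> feasible (UNIV :: 2 set, q). min (x $ 1) (x $ 2) < min (y $ 1) (y $ 2))"
    for x :: "real ^ 2"
  proof -
    have "vector [q / 2, q / 2] \<in> feasible (UNIV :: 2 set, q)"
      using \<open>0 \<le> q\<close> by (simp add: feasible_2)
    with max have "\<not> min (x $ 1) (x $ 2) < q / 2" by fastforce
    with x show ?thesis by (auto simp: feasible_2 vec_eq_iff forall_2)
  qed
  moreover have "vector [q / 2, q / 2] \<in> feasible (UNIV :: 2 set, q)"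
    "\<not> (\<exists>y \<in> feasible (UNIV :: 2 set, q).
        min ((vector [q / 2, q / 2] :: real ^ 2) $ 1) ((vector [q / 2, q / 2] :: real ^ 2) $ 2)
          < min (y $ 1) (y $ 2))"
    using that by (auto simp: feasible_2)
  ultimately have eq: "is_arg_max (\<lambda>x :: real ^ 2. MIN i\<in>UNIV. x $ i) (\<lambda>x. x \<in> feasible (UNIV, q)) x
      \<longleftrightarrow> x = vector [q / 2, q / 2]" for x
    by blast
  show ?thesis unfolding water_filling_def by (simp add: ext[OF eq, simplified])
qed

text \<open>The feasible set is a single point, which therefore maximizes any objective.\<close>

lemma water_filling_singleton:
  "snd water_filling () (E @ [({i}, q)]) xs = (axis i q :: real ^ 2)" if "0 \<le> q"
  using that by (simp add: water_filling_def is_arg_max_def feasible_singleton conj_commute cong: conj_cong)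

lemma decreasing_rearrangement_2:
  "decreasing_rearrangement x = [max (x $ 1) (x $ 2), min (x $ 1) (x $ 2)]" for x :: "real ^ 2"
  by (simp add: decreasing_rearrangement_def UNIV_2 max_def min_def)

theorem theorem2:
  fixes f :: "real ^ 2 \<Rightarrow> real"
  assumes f: "\<And>x. x \<in> nonneg_vecs \<Longrightarrow> f x = (if x $ 1 > 1/2 \<and> x $ 2 > 1/2 then 1 else 0)"
  shows "schur_concave_on nonneg_vecs f \<and>
    (\<exists>A :: (real, 2) policy. allocation_policy A \<and>
      (\<forall>\<alpha> :: real. \<alpha> > 0 \<longrightarrow>
         regret_max 2 2 \<alpha> f A \<le> ereal (max (\<alpha> - 1/2) 0) \<and>
         max (\<alpha> - 1/2) 0 < \<alpha> \<and>
         ereal \<alpha> \<le> regret_max 2 2 \<alpha> f water_filling))"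
proof -
  have schur: "schur_concave_on nonneg_vecs f"
    unfolding schur_concave_on_def
  proof (intro ballI impI)
    fix x y :: "real ^ 2"
    assume xy: "x \<in> nonneg_vecs" "y \<in> nonneg_vecs" and "majorized_by x y"
    then have "\<forall>k\<le>2. sum_list (take k (decreasing_rearrangement x))
                     \<le> sum_list (take k (decreasing_rearrangement y))"
      and "x $ 1 + x $ 2 = y $ 1 + y $ 2"
      by (auto simp: majorized_by_def sum_2)
    \<comment> \<open>The case \<open>k = 1\<close> compares the maxima; as the sums agree, the
      minimum of \<open>x\<close> is at least that of \<open>y\<close>, and \<open>f\<close> is
      nondecreasing in the minimum.\<close>
    from this(1)[rule_format, of 1] this(2) show "f y \<le> f x"
      by (auto simp: f xy decreasing_rearrangement_2 max_def split: if_splits)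
  qed
  have f_load: "f (x + y) = (if \<forall>i. 1/2 < (x + y) $ i then 1 else 0)"
    if "x \<in> feasible r" "y \<in> feasible s" for x y r s
    using that by (subst f) (auto simp: feasible_def nonneg_vecs_def forall_2 split: prod.splits)
  \<comment> \<open>On feasible loads \<open>f\<close> takes only the values 0 and 1. The points
    \<open>x0\<close> and \<open>y0\<close> make the set of loads nonempty, so that 0 is attained
    when success is impossible.\<close>
  have greatest: "(GREATEST v. v \<in> f ` feasible_loads [r, s]) =
      (if \<exists>x\<in>feasible r. \<exists>y\<in>feasible s. \<forall>i. 1/2 < (x + y) $ i then 1 else 0)"
    if "x0 \<in> feasible r" "y0 \<in> feasible s" for r s x0 y0
  proof (rule Greatest_equality)
    show "(if \<exists>x\<in>feasible r. \<exists>y\<in>feasible s. \<forall>i. 1/2 < (x + y) $ i then 1 else 0)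
        \<in> f ` feasible_loads [r, s]" (is "?v \<in> _")
    proof (cases "\<exists>x\<in>feasible r. \<exists>y\<in>feasible s. \<forall>i. 1/2 < (x + y) $ i")
      case True
      then obtain x y where xy: "x \<in> feasible r" "y \<in> feasible s" "\<forall>i. 1/2 < (x + y) $ i" by blast
      then have "?v = f (x + y)" using True f_load[OF xy(1,2)] by simp
      then show ?thesis using xy unfolding feasible_loads_two by blast
    next
      case False
      then have "?v = f (x0 + y0)" using that f_load[OF that] by auto
      then show ?thesis using that unfolding feasible_loads_two by blast
    qed
  next
    fix v assume "v \<in> f ` feasible_loads [r, s]"
    then obtain x y where "x \<in> feasible r" "y \<in> feasible s" "v = f (x + y)"
      unfolding feasible_loads_two by blast
    with f_load[of x r y s]
    show "v \<le> (if \<exists>x\<in>feasible r. \<exists>y\<in>feasible s. \<forall>i. 1/2 < (x + y) $ i then 1 else 0)"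
      by auto
  qed
  have upper: "regret_max 2 2 \<alpha> f coin_policy \<le> ereal (max (\<alpha> - 1/2) 0)" if \<alpha>: "0 < \<alpha>" for \<alpha>
    unfolding regret_max_def
  proof (rule SUP_least)
    fix E :: "2 request list" assume "E \<in> request_seqs 2 2"
    then obtain N q N' q' where E: "E = [(N, q), (N', q')]"
      and N: "N \<noteq> {}" "N' \<noteq> {}" and q: "0 < q" "0 < q'" "q + q' = 2"
      by (rule request_seqs_two_cases)
    define x where "x \<omega> = coin_rule \<omega> [(N, q)] []" for \<omega>
    define y where "y \<omega> = coin_rule \<omega> E [x \<omega>]" for \<omega>
    have xy: "x \<omega> \<in> feasible (N, q)" "y \<omega> \<in> feasible (N', q')" for \<omega>
      using coin_rule_feasible[of N q \<omega> "[]"] coin_rule_feasible[of N' q' \<omega> "[(N, q)]"] N q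
      by (auto simp: x_def y_def E)
    have load: "final_load coin_policy E \<omega> = x \<omega> + y \<omega>" for \<omega>
      by (simp add: E final_load_two coin_policy_def x_def y_def)
    have f_final: "f (final_load coin_policy E \<omega>) = (if \<forall>i. 1/2 < final_load coin_policy E \<omega> $ i then 1 else 0)"
      for \<omega>
      unfolding load by (rule f_load[OF xy])
    show "ereal (\<alpha> * (GREATEST v. v \<in> f ` feasible_loads E)
        - (\<integral>\<omega>. f (final_load coin_policy E \<omega>) \<partial>fst coin_policy)) \<le> ereal (max (\<alpha> - 1/2) 0)"
    proof (cases "\<exists>u\<in>feasible (N, q). \<exists>v\<in>feasible (N', q'). \<forall>i. 1/2 < (u + v) $ i")
      case True
      then obtain \<omega> where "\<omega> \<in> {0, 1}" "\<forall>i. 1/2 < final_load coin_policy E \<omega> $ i"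
        using coin_success[OF N q] unfolding E by blast
      \<comment> \<open>One successful seed out of two gives expected value at least 1/2, hence
        regret at most \<open>\<alpha> - 1/2\<close>.\<close>
      then have "1 \<le> f (final_load coin_policy E 0) + f (final_load coin_policy E 1)"
        unfolding f_final by (auto simp del: less_divide_eq_numeral1)
      moreover have "(GREATEST v. v \<in> f ` feasible_loads E) = 1"
        unfolding E greatest[OF xy] using True by simp
      ultimately have "\<alpha> * (GREATEST v. v \<in> f ` feasible_loads E)
          - (\<integral>\<omega>. f (final_load coin_policy E \<omega>) \<partial>fst coin_policy) \<le> max (\<alpha> - 1/2) 0"
        unfolding integral_coin_policy by (simp add: le_max_iff_disj)
      then show ?thesis by (simp only: ereal_less_eq)
    next
      case False
      \<comment> \<open>With optimum 0 the regret is at most 0, the other argument of the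
        maximum.\<close>
      then have "(GREATEST v. v \<in> f ` feasible_loads E) = 0"
        unfolding E greatest[OF xy] by simp
      moreover have "0 \<le> f (final_load coin_policy E \<omega>)" for \<omega>
        unfolding f_final by simp
      ultimately have "\<alpha> * (GREATEST v. v \<in> f ` feasible_loads E)
          - (\<integral>\<omega>. f (final_load coin_policy E \<omega>) \<partial>fst coin_policy) \<le> max (\<alpha> - 1/2) 0"
        unfolding integral_coin_policy by (simp add: le_max_iff_disj)
      then show ?thesis by (simp only: ereal_less_eq)
    qed
  qed
  have lower: "ereal \<alpha> \<le> regret_max 2 2 \<alpha> f water_filling" for \<alpha>
  proof -
    define E :: "2 request list" where "E = [(UNIV, 1), ({1}, 1)]"
    have mem: "axis 2 1 \<in> feasible (UNIV :: 2 set, 1)" "axis 1 1 \<in> feasible ({1 :: 2}, 1)"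
      by (simp_all add: feasible_2 axis_def)
    moreover have "\<forall>i. 1/2 < (axis 2 1 + axis 1 1 :: real ^ 2) $ i"
      by (simp add: forall_2 axis_def)
    ultimately have opt: "(GREATEST v. v \<in> f ` feasible_loads E) = 1"
      unfolding E_def greatest[OF mem] by auto
    have "final_load water_filling E () = vector [1/2, 1/2] + axis 1 1"
      using water_filling_first[of 1] water_filling_singleton[of 1 "[(UNIV, 1)]" 1]
      by (simp add: E_def final_load_two)
    \<comment> \<open>The load is (3/2, 1/2), and the strict threshold fails at node 2.\<close>
    then have wf: "f (final_load water_filling E ()) = 0"
      by (subst f) (auto simp: nonneg_vecs_def forall_2 axis_def)
    have "E \<in> request_seqs 2 2"
      by (auto simp: E_def request_seqs_def valid_requests_def)
    then show ?thesis
      unfolding regret_max_def by (rule SUP_upper2) (simp add: opt wf)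
  qed
  show ?thesis
    using schur allocation_policy_coin upper lower by (intro conjI exI[of _ coin_policy]) auto
qed

end
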